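(* Let $\pi$ be a local primal optimizer for a given feasible neighbourhood $\mathcal{N}\subset X\times Y$ and let $\mathcal{N}$ be shielding for $\pi$. Then $\pi$ is globally optimal, i.e. $\pi$ minimizes $C$ over all of $\Pi(\mu,\nu)$.
   Context: $X$, $Y$ are discrete finite sets, $\mu$, $\nu$ are probability measures on $X$, $Y$, and $c : X \times Y \to \mathbb{R}\cup\{\infty\}$ is a cost function. $\Pi(\mu,\nu)$ is the set of couplings, i.e. probability measures $\pi$ on $X\times Y$ with $\pi(\{x\}\times Y)=\mu(x)$ and $\pi(X\times\{y\})=\nu(y)$ for all $x\in X$, $y\in Y$. The support of $\pi$ is $\mathrm{spt}\,\pi=\{(x,y)\in X\times Y : \pi(x,y)>0\}$ and its total transport cost is $C(\pi)=\sum_{(x,y)\in X\times Y} c(x,y)\,\pi(x,y)$. The full optimal transport problem is to minimize $C$ over $\Pi(\mu,\nu)$. A neighbourhood is a subset $\mathcal{N}\subset X\times Y$. The problem restricted to $\mathcal{N}$ is to minimize $C(\pi)$ over all $\pi\in\Pi(\mu,\nu)$ subject to the additional constraint $\mathrm{spt}\,\pi\subset\mathcal{N}$. The neighbourhood $\mathcal{N}$ is feasible if the optimal value of this restricted problem is finite, and $\pi$ is a local primal optimizer w.r.t. $\mathcal{N}$ if it solves this restricted problem. Shielding condition: for $x_A\in X$, $(x_s,y_s)\in X\times Y$ and $y_B\in Y$, we say that $(x_s,y_s)$ shields $x_A$ from $y_B$ when $$c(x_A,y_B)-c(x_s,y_B)>c(x_A,y_s)-c(x_s,y_s).$$ Shielding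 neighbourhood: for a given coupling $\pi$, a neighbourhood $\mathcal{N}\subset X\times Y$ with $\mathcal{N}\supset\mathrm{spt}\,\pi$ is shielding for $\pi$ if for every pair $(x_A,y_B)\in X\times Y$ at least one of the following is true: (i) $(x_A,y_B)\in\mathcal{N}$; (ii) there exists some $(x_s,y_s)\in\mathrm{spt}\,\pi$ with $(x_A,y_s)\in\mathcal{N}$ such that $(x_s,y_s)$ shields $x_A$ from $y_B$. *)

theory Defs
  imports "HOL-Probability.Probability_Mass_Function"
begin

text \<open>
  The finite sets \<open>X\<close> and \<open>Y\<close> are the types \<open>'a\<close> and \<open>'b\<close> of class \<open>finite\<close>.
  A cost function with values in the reals extended by \<open>\<infinity>\<close> is an \<open>ereal\<close>-valued function
  that avoids \<open>-\<infinity>\<close>; the latter is assumed where it is needed.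
\<close>

definition couplings :: "'a::finite pmf \<Rightarrow> 'b::finite pmf \<Rightarrow> ('a \<times> 'b) pmf set" where
  "couplings \<mu> \<nu> =
     {\<pi>. (\<forall>x. measure_pmf.prob \<pi> ({x} \<times> UNIV) = pmf \<mu> x) \<and>
          (\<forall>y. measure_pmf.prob \<pi> (UNIV \<times> {y}) = pmf \<nu> y)}"

text \<open>Products in \<open>ereal\<close> satisfy \<open>\<infinity> * 0 = 0\<close>, so infinite costs off the support do not matter.\<close>

definition transport_cost :: "('a::finite \<times> 'b::finite \<Rightarrow> ereal) \<Rightarrow> ('a \<times> 'b) pmf \<Rightarrow> ereal" where
  "transport_cost c \<pi> = (\<Sum>(x, y)\<in>UNIV. c (x, y) * ereal (pmf \<pi> (x, y)))"

text \<open>The support of \<open>\<pi>\<close> is \<open>set_pmf \<pi>\<close>, the set of points of nonzero mass.\<close>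

definition restricted_couplings ::
  "'a::finite pmf \<Rightarrow> 'b::finite pmf \<Rightarrow> ('a \<times> 'b) set \<Rightarrow> ('a \<times> 'b) pmf set" where
  "restricted_couplings \<mu> \<nu> N = {\<pi> \<in> couplings \<mu> \<nu>. set_pmf \<pi> \<subseteq> N}"

text \<open>If there is no coupling supported in \<open>N\<close>, the infimum below is \<open>\<infinity>\<close>.\<close>

definition feasible ::
  "('a::finite \<times> 'b::finite \<Rightarrow> ereal) \<Rightarrow> 'a pmf \<Rightarrow> 'b pmf \<Rightarrow> ('a \<times> 'b) set \<Rightarrow> bool" where
  "feasible c \<mu> \<nu> N \<longleftrightarrow> \<bar>INF \<pi>\<in>restricted_couplings \<mu> \<nu> N. transport_cost c \<pi>\<bar> \<noteq> \<infinity>"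

definition local_primal_optimizer ::
  "('a::finite \<times> 'b::finite \<Rightarrow> ereal) \<Rightarrow> 'a pmf \<Rightarrow> 'b pmf \<Rightarrow> ('a \<times> 'b) set
    \<Rightarrow> ('a \<times> 'b) pmf \<Rightarrow> bool" where
  "local_primal_optimizer c \<mu> \<nu> N \<pi> \<longleftrightarrow>
     is_arg_min (transport_cost c) (\<lambda>\<pi>'. \<pi>' \<in> restricted_couplings \<mu> \<nu> N) \<pi>"

definition globally_optimal ::
  "('a::finite \<times> 'b::finite \<Rightarrow> ereal) \<Rightarrow> 'a pmf \<Rightarrow> 'b pmf \<Rightarrow> ('a \<times> 'b) pmf \<Rightarrow> bool" where
  "globally_optimal c \<mu> \<nu> \<pi> \<longleftrightarrow> is_arg_min (transport_cost c) (\<lambda>\<pi>'. \<pi>' \<in> couplings \<mu> \<nu>) \<pi>"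

text \<open>
  In \<open>ereal\<close>, \<open>\<infinity> - \<infinity> = \<infinity>\<close>. Let \<open>(xs, ys)\<close> have finite cost, as every support point of a
  coupling of finite cost does. Then the only undefined difference that can arise is the left one,
  when \<open>c (xA, yB) = c (xs, yB) = \<infinity>\<close>; the inequality then holds iff \<open>c (xA, ys) < \<infinity>\<close>.
  This is the permissive reading: whatever is shielding when undefined differences are
  disallowed is also shielding here.
\<close>

definition shields ::
  "('a \<times> 'b \<Rightarrow> ereal) \<Rightarrow> 'a \<times> 'b \<Rightarrow> 'a \<Rightarrow> 'b \<Rightarrow> bool" where
  "shields c s xA yB \<longleftrightarrow>
     (case s of (xs, ys) \<Rightarrow> c (xA, yB) - c (xs, yB) > c (xA, ys) - c (xs, ys))"

definition shielding ::
  "('a \<times> 'b \<Rightarrow> ereal) \<Rightarrow> ('a \<times> 'b) pmf \<Rightarrow> ('a \<times> 'b) set \<Rightarrow> bool" where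
  "shielding c \<pi> N \<longleftrightarrow> set_pmf \<pi> \<subseteq> N \<and>
     (\<forall>xA yB. (xA, yB) \<in> N \<or>
        (\<exists>xs ys. (xs, ys) \<in> set_pmf \<pi> \<and> (xA, ys) \<in> N \<and> shields c (xs, ys) xA yB))"

end

theory Submission
  imports Defs
begin

text \<open>
  Optimality of \<open>\<pi>\<close> within \<open>N\<close> is certified by linear programming duality: there are real
  potentials \<open>\<alpha>\<close>, \<open>\<beta>\<close> with \<open>\<alpha> x + \<beta> y \<le> c (x, y)\<close> on \<open>N\<close> and equality on the support of \<open>\<pi>\<close>
  (\<open>optimal_plan_has_potentials\<close>, a consequence of Farkas' lemma applied to the finite-cost part of
  \<open>N\<close>). If the inequality holds on all of \<open>X \<times> Y\<close>, then \<open>\<pi>\<close> is globally optimal: the sum of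
  \<open>\<alpha> x + \<beta> y\<close> against a coupling depends only on the marginals, it equals the cost of \<open>\<pi>\<close>, and
  it bounds the cost of every other coupling from below.

  The shielding condition is what carries the inequality from \<open>N\<close> to \<open>X \<times> Y\<close>
  (\<open>shielding_extends_dual_feasibility\<close>). Consider the reduced cost
  \<open>r (x, y) = c (x, y) - \<alpha> x - \<beta> y\<close>. If \<open>(xs, ys)\<close> shields \<open>xA\<close> from \<open>yB\<close>, the potentials cancel in
  the shielding inequality and leave
  \<open>r (xA, yB) > r (xs, yB) + r (xA, ys) - r (xs, ys) \<ge> r (xs, yB)\<close>,
  because \<open>r (xs, ys) = 0\<close> and \<open>r (xA, ys) \<ge> 0\<close>. So in each column \<open>yB\<close> with a point of finite cost
  the reduced cost is minimal at a point of \<open>N\<close>, where it is nonnegative. The infinite values of \<open>c\<close> do no harm: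
  points of infinite cost satisfy the dual inequality trivially, and descending from a point of
  finite cost leads to points of finite cost.
\<close>

section \<open>Linear programming duality\<close>

text \<open>
  A finitely generated convex cone is a polyhedron and hence closed, so a point outside it is
  strictly separated from it by a hyperplane. On a cone, a linear functional that is bounded below
  is nonnegative.
\<close>

lemma farkas:
  fixes v :: "'i \<Rightarrow> 'v::euclidean_space"
  assumes "finite I"
    and no_comb: "\<And>u. (\<And>i. i \<in> I \<Longrightarrow> 0 \<le> u i) \<Longrightarrow> (\<Sum>i\<in>I. u i *\<^sub>R v i) \<noteq> w"
  obtains a where "\<And>i. i \<in> I \<Longrightarrow> 0 \<le> a \<bullet> v i" and "a \<bullet> w < 0"
proof -
  define K where "K = {\<Sum>i\<in>I. u i *\<^sub>R v i | u :: 'i \<Rightarrow> real. \<forall>i\<in>I. 0 \<le> u i}"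
  define H where "H = convex_cone hull (v ` I)"
  have "convex_cone K"
    unfolding convex_cone_iff
  proof (intro conjI ballI allI impI)
    show "0 \<in> K"
      unfolding K_def by (auto intro!: exI[of _ "\<lambda>_. 0"])
  next
    fix x y assume "x \<in> K" "y \<in> K"
    then obtain s t where "\<forall>i\<in>I. 0 \<le> s i" "\<forall>i\<in>I. 0 \<le> t i"
      "x = (\<Sum>i\<in>I. s i *\<^sub>R v i)" "y = (\<Sum>i\<in>I. t i *\<^sub>R v i)"
      unfolding K_def by auto
    then show "x + y \<in> K"
      unfolding K_def
      by (auto intro!: exI[of _ "\<lambda>i. s i + t i"] simp: scaleR_left_distrib sum.distrib)
  next
    fix x and r :: real assume "x \<in> K" "0 \<le> r"
    then obtain s where "\<forall>i\<in>I. 0 \<le> s i" "x = (\<Sum>i\<in>I. s i *\<^sub>R v i)"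
      unfolding K_def by auto
    with \<open>0 \<le> r\<close> show "r *\<^sub>R x \<in> K"
      unfolding K_def by (auto intro!: exI[of _ "\<lambda>i. r * s i"] simp: scaleR_right.sum)
  qed
  moreover have "v i \<in> K" if "i \<in> I" for i
    unfolding K_def using that \<open>finite I\<close>
    by (auto intro!: exI[of _ "\<lambda>j. of_bool (j = i)"] simp: sum.remove[of I i])
  ultimately have "H \<subseteq> K"
    unfolding H_def by (intro hull_minimal) auto
  moreover have "w \<notin> K"
    unfolding K_def using no_comb by auto
  ultimately have "w \<notin> H"
    by auto
  moreover have "closed H" "convex H"
    using \<open>finite I\<close> unfolding H_def
    by (auto intro: polyhedron_imp_closed polyhedron_convex_cone_hull convex_convex_cone_hull)
  ultimately obtain a b where "a \<bullet> w < b" and above: "\<And>x. x \<in> H \<Longrightarrow> b < a \<bullet> x"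
    using separating_hyperplane_closed_point by metis
  have "b < 0"
    using above[of 0] by (simp add: H_def convex_cone_hull_contains_0)
  have "0 \<le> a \<bullet> v i" if "i \<in> I" for i
  proof (rule ccontr)
    assume neg: "\<not> 0 \<le> a \<bullet> v i"
    have "v i \<in> H"
      using that unfolding H_def by (simp add: hull_inc)
    \<comment> \<open>The multiple of \<open>v i\<close> that lies on the separating hyperplane belongs to the cone.\<close>
    then have "(b / (a \<bullet> v i)) *\<^sub>R v i \<in> H"
      unfolding H_def using \<open>b < 0\<close> neg
      by (intro convex_cone_hull_mul) (auto simp: divide_simps)
    from above[OF this] neg show False
      by simp
  qed
  moreover have "a \<bullet> w < 0"
    using \<open>a \<bullet> w < b\<close> \<open>b < 0\<close> by simp
  ultimately show ?thesis
    using that by blast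
qed

lemma sum_UNIV_prod:
  fixes f :: "'a::finite \<times> 'b::finite \<Rightarrow> real"
  shows "(\<Sum>e\<in>UNIV. f e) = (\<Sum>x\<in>UNIV. \<Sum>y\<in>UNIV. f (x, y))"
  by (simp add: sum.cartesian_product)

text \<open>Functions of the form \<open>\<alpha> x + \<beta> y\<close> have the same total under all couplings.\<close>

lemma potential_cost_eq_marginals:
  fixes q :: "'a::finite \<times> 'b::finite \<Rightarrow> real"
  shows "(\<Sum>e\<in>UNIV. (\<alpha> (fst e) + \<beta> (snd e)) * q e) =
    (\<Sum>x\<in>UNIV. \<alpha> x * (\<Sum>y\<in>UNIV. q (x, y))) + (\<Sum>y\<in>UNIV. \<beta> y * (\<Sum>x\<in>UNIV. q (x, y)))"
proof -
  have "(\<Sum>e\<in>UNIV. \<beta> (snd e) * q e) = (\<Sum>y\<in>UNIV. \<Sum>x\<in>UNIV. \<beta> y * q (x, y))"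
    by (subst sum.swap) (simp add: sum_UNIV_prod)
  then show ?thesis
    by (simp add: distrib_right sum.distrib sum_UNIV_prod sum_distrib_left)
qed

text \<open>
  Sending one unit of mass through \<open>e = (x, y)\<close> contributes the vector
  \<open>g e = (axis x 1, axis y 1, k e)\<close> of its two marginals and its cost. Let \<open>T\<close> be the total of \<open>p\<close>,
  that is, the triple of the marginals and the cost \<open>C\<close> of \<open>p\<close>. If \<open>(0, 0, -1)\<close> lay in the cone
  generated by \<open>-T\<close> and the \<open>g e\<close> with \<open>e \<in> E\<close>, then with \<open>s\<close> the coefficient of \<open>-T\<close> some plan on
  \<open>E\<close> would have \<open>s\<close> times the marginals of \<open>p\<close> and cost \<open>s * C - 1\<close>; rescaled by \<open>1 / s\<close> it
  would beat \<open>p\<close>. So Farkas' lemma gives a functional \<open>a\<close> with positive cost coefficient \<open>t\<close> that is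
  nonnegative on the \<open>g e\<close> and nonpositive on \<open>T\<close>. Since \<open>T\<close> is the combination of the \<open>g e\<close>
  with weights \<open>p e\<close>, the functional vanishes on every \<open>g e\<close> with \<open>p e > 0\<close>. Dividing its marginal
  part by \<open>- t\<close> yields the potentials.
\<close>

lemma optimal_plan_has_potentials:
  fixes k p :: "'a::finite \<times> 'b::finite \<Rightarrow> real"
  assumes p_nonneg: "\<And>e. 0 \<le> p e" and p_supp: "\<And>e. e \<notin> E \<Longrightarrow> p e = 0"
    and opt: "\<And>q. \<lbrakk>\<And>e. 0 \<le> q e; \<And>e. e \<notin> E \<Longrightarrow> q e = 0;
        \<And>x. (\<Sum>y\<in>UNIV. q (x, y)) = (\<Sum>y\<in>UNIV. p (x, y));
        \<And>y. (\<Sum>x\<in>UNIV. q (x, y)) = (\<Sum>x\<in>UNIV. p (x, y))\<rbrakk>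
      \<Longrightarrow> (\<Sum>e\<in>UNIV. k e * p e) \<le> (\<Sum>e\<in>UNIV. k e * q e)"
  obtains \<alpha> \<beta> where "\<And>x y. (x, y) \<in> E \<Longrightarrow> \<alpha> x + \<beta> y \<le> k (x, y)"
    and "\<And>x y. 0 < p (x, y) \<Longrightarrow> \<alpha> x + \<beta> y = k (x, y)"
proof -
  define C where "C = (\<Sum>e\<in>UNIV. k e * p e)"
  define row where "row q = (\<chi> x. \<Sum>y\<in>UNIV. q (x, y))" for q :: "'a \<times> 'b \<Rightarrow> real"
  define col where "col q = (\<chi> y. \<Sum>x\<in>UNIV. q (x, y))" for q :: "'a \<times> 'b \<Rightarrow> real"
  define g :: "'a \<times> 'b \<Rightarrow> (real^'a) \<times> (real^'b) \<times> real"
    where "g e = (axis (fst e) 1, axis (snd e) 1, k e)" for e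
  have sum_g: "(\<Sum>e\<in>UNIV. q e *\<^sub>R g e) = (row q, col q, \<Sum>e\<in>UNIV. k e * q e)" for q
  proof -
    have "(\<Sum>e\<in>UNIV. q e *\<^sub>R axis (fst e) (1::real)) = row q"
      by (simp add: vec_eq_iff row_def axis_def sum_UNIV_prod if_distrib if_distribR cong: if_cong)
         (simp add: sum.swap[of _ UNIV UNIV])
    moreover have "(\<Sum>e\<in>UNIV. q e *\<^sub>R axis (snd e) (1::real)) = col q"
      by (simp add: vec_eq_iff col_def axis_def sum_UNIV_prod if_distrib if_distribR cong: if_cong)
    ultimately show ?thesis
      by (simp add: g_def sum_prod fst_sum snd_sum prod_eq_iff mult.commute)
  qed
  define v where "v = case_option (- (row p, col p, C)) g"
  define I where "I = insert None (Some ` E)"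
  have "finite I"
    by (simp add: I_def)
  have not_comb: "(\<Sum>i\<in>I. u i *\<^sub>R v i) \<noteq> (0, 0, -1)" if u: "\<And>i. i \<in> I \<Longrightarrow> 0 \<le> u i" for u
  proof
    assume comb: "(\<Sum>i\<in>I. u i *\<^sub>R v i) = (0, 0, -1)"
    define s where "s = u None"
    define q where "q e = (if e \<in> E then u (Some e) else 0)" for e
    have q: "0 \<le> q e" "e \<notin> E \<Longrightarrow> q e = 0" for e
      using u by (auto simp: q_def I_def)
    have "0 \<le> s"
      using u by (auto simp: s_def I_def)
    have "(\<Sum>i\<in>I. u i *\<^sub>R v i) = s *\<^sub>R v None + (\<Sum>e\<in>E. u (Some e) *\<^sub>R v (Some e))"
      unfolding I_def s_def by (subst sum.insert) (auto simp: sum.reindex)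
    also have "(\<Sum>e\<in>E. u (Some e) *\<^sub>R v (Some e)) = (\<Sum>e\<in>UNIV. q e *\<^sub>R g e)"
      by (intro sum.mono_neutral_cong_left) (auto simp: q_def v_def)
    finally have eq: "row q = s *\<^sub>R row p" "col q = s *\<^sub>R col p"
        "(\<Sum>e\<in>UNIV. k e * q e) = s * C - 1"
      using comb by (auto simp: sum_g v_def)
    have rows: "(\<Sum>y\<in>UNIV. q (x, y)) = s * (\<Sum>y\<in>UNIV. p (x, y))" for x
      using eq(1) by (simp add: row_def vec_eq_iff)
    have cols: "(\<Sum>x\<in>UNIV. q (x, y)) = s * (\<Sum>x\<in>UNIV. p (x, y))" for y
      using eq(2) by (simp add: col_def vec_eq_iff)
    show False
    proof (cases "s = 0")
      case True
      \<comment> \<open>A nonnegative plan with zero marginals vanishes, so it cannot have cost \<open>-1\<close>.\<close>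
      with rows q have "q (x, y) = 0" for x y
        by (simp add: sum_nonneg_eq_0_iff)
      then have "q e = 0" for e
        by (cases e) simp
      with eq(3) True show False
        by simp
    next
      case False
      with \<open>0 \<le> s\<close> have "0 < s"
        by simp
      have "C \<le> (\<Sum>e\<in>UNIV. k e * (q e / s))"
        unfolding C_def using \<open>0 < s\<close> q rows cols
        by (intro opt) (auto simp flip: sum_divide_distrib)
      also have "\<dots> = (s * C - 1) / s"
        by (simp add: eq(3) flip: sum_divide_distrib)
      finally show False
        using \<open>0 < s\<close> by (simp add: field_simps)
    qed
  qed
  obtain a where a_nonneg: "\<And>i. i \<in> I \<Longrightarrow> 0 \<le> a \<bullet> v i" and a_neg: "a \<bullet> (0, 0, -1) < 0"
    by (rule farkas[OF \<open>finite I\<close> not_comb]) blast+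
  obtain A B t where a: "a = (A, B, t)"
    by (cases a) auto
  have "0 < t"
    using a_neg by (simp add: a inner_prod_def)
  have a_g: "a \<bullet> g (x, y) = A $ x + B $ y + t * k (x, y)" for x y
    by (simp add: a g_def inner_prod_def inner_axis)
  have reduced_nonneg: "0 \<le> a \<bullet> g e" if "e \<in> E" for e
    using a_nonneg[of "Some e"] that by (simp add: I_def v_def)
  have "(\<Sum>e\<in>UNIV. p e * (a \<bullet> g e)) = a \<bullet> (\<Sum>e\<in>UNIV. p e *\<^sub>R g e)"
    by (simp add: inner_sum_right)
  also have "\<dots> = - (a \<bullet> v None)"
    by (simp add: sum_g v_def C_def inner_prod_def)
  finally have "(\<Sum>e\<in>UNIV. p e * (a \<bullet> g e)) \<le> 0"
    using a_nonneg[of None] by (simp add: I_def)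
  moreover have nonneg: "0 \<le> p e * (a \<bullet> g e)" for e
    using p_nonneg[of e] p_supp[of e] reduced_nonneg[of e] by (cases "e \<in> E") auto
  ultimately have "(\<Sum>e\<in>UNIV. p e * (a \<bullet> g e)) = 0"
    by (intro antisym sum_nonneg) auto
  then have slack: "p e * (a \<bullet> g e) = 0" for e
    using nonneg by (cases e) (simp add: sum_nonneg_eq_0_iff)
  show ?thesis
  proof (rule that[of "\<lambda>x. - A $ x / t" "\<lambda>y. - B $ y / t"])
    fix x y assume "(x, y) \<in> E"
    then show "- A $ x / t + - B $ y / t \<le> k (x, y)"
      using reduced_nonneg[of "(x, y)"] \<open>0 < t\<close> unfolding a_g by (simp add: field_simps)
  next
    fix x y assume "0 < p (x, y)"
    then have "A $ x + B $ y + t * k (x, y) = 0"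
      using slack[of "(x, y)"] by (simp add: a_g)
    then show "- A $ x / t + - B $ y / t = k (x, y)"
      using \<open>0 < t\<close> by (simp add: field_simps)
  qed
qed

section \<open>Shielding\<close>

text \<open>
  For a fixed column \<open>y\<close>, shielding strictly lowers the reduced cost when passing from a violating
  point outside \<open>N\<close> to the shielding point's row. A violating point of least reduced cost in that
  column can therefore be neither inside nor outside \<open>N\<close>.
\<close>

lemma shielding_extends_dual_feasibility:
  fixes c :: "'a::finite \<times> 'b::finite \<Rightarrow> ereal"
  assumes not_MInf: "\<And>e. c e \<noteq> -\<infinity>"
    and feas: "\<And>x y. (x, y) \<in> N \<Longrightarrow> ereal (\<alpha> x + \<beta> y) \<le> c (x, y)"
    and tight: "\<And>x y. (x, y) \<in> set_pmf \<pi> \<Longrightarrow> c (x, y) = ereal (\<alpha> x + \<beta> y)"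
    and "shielding c \<pi> N"
  shows "ereal (\<alpha> x + \<beta> y) \<le> c (x, y)"
proof (rule ccontr)
  define bad where "bad = {x. c (x, y) < ereal (\<alpha> x + \<beta> y)}"
  define r where "r x = real_of_ereal (c (x, y)) - \<alpha> x" for x
  assume "\<not> ereal (\<alpha> x + \<beta> y) \<le> c (x, y)"
  then have "x \<in> bad"
    unfolding bad_def by (simp add: not_le)
  then have "bad \<noteq> {}"
    by blast
  moreover have "finite bad"
    by simp
  ultimately obtain z where "z \<in> bad" and least: "\<And>x. x \<in> bad \<Longrightarrow> r z \<le> r x"
    using arg_min_if_finite[of bad r] by (metis not_le)
  then have "(z, y) \<notin> N"
    using feas by (force simp: bad_def not_le[symmetric])
  then obtain xs ys where s: "(xs, ys) \<in> set_pmf \<pi>" and "(z, ys) \<in> N"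
    and sh: "c (z, y) - c (xs, y) > c (z, ys) - c (xs, ys)"
    using \<open>shielding c \<pi> N\<close> by (force simp: shielding_def shields_def)
  obtain czy where czy: "c (z, y) = ereal czy"
    using \<open>z \<in> bad\<close> not_MInf[of "(z, y)"] by (cases "c (z, y)") (auto simp: bad_def)
  \<comment> \<open>The strict shielding inequality rules out infinite cost at \<open>(xs, y)\<close>, where its left side would
    be \<open>-\<infinity>\<close>, and at \<open>(z, ys)\<close>, where its right side would be \<open>\<infinity>\<close>.\<close>
  obtain csy where csy: "c (xs, y) = ereal csy"
    using sh czy not_MInf[of "(xs, y)"] by (cases "c (xs, y)") auto
  obtain czs where czs: "c (z, ys) = ereal czs"
    using sh czy csy tight[OF s] not_MInf[of "(z, ys)"] by (cases "c (z, ys)") auto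
  have "\<alpha> z + \<beta> ys \<le> czs"
    using feas[OF \<open>(z, ys) \<in> N\<close>] czs by simp
  with sh have "r xs < r z"
    using czy csy czs tight[OF s] by (simp add: r_def)
  moreover have "r z < \<beta> y"
    using \<open>z \<in> bad\<close> czy by (simp add: bad_def r_def)
  ultimately have "xs \<in> bad"
    using csy by (simp add: bad_def r_def)
  with least[of xs] \<open>r xs < r z\<close> show False
    by simp
qed

section \<open>Couplings and their costs as finite sums\<close>

lemma couplings_iff_marginals:
  "\<pi> \<in> couplings \<mu> \<nu> \<longleftrightarrow>
    (\<forall>x. (\<Sum>y\<in>UNIV. pmf \<pi> (x, y)) = pmf \<mu> x) \<and> (\<forall>y. (\<Sum>x\<in>UNIV. pmf \<pi> (x, y)) = pmf \<nu> y)"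
proof -
  have "measure_pmf.prob \<pi> ({x} \<times> UNIV) = (\<Sum>y\<in>UNIV. pmf \<pi> (x, y))" for x
    by (simp add: measure_measure_pmf_finite sum.cartesian_product')
  moreover have "measure_pmf.prob \<pi> (UNIV \<times> {y}) = (\<Sum>x\<in>UNIV. pmf \<pi> (x, y))" for y
    by (simp add: measure_measure_pmf_finite sum.cartesian_product')
  ultimately show ?thesis
    by (simp add: couplings_def)
qed

lemma coupling_of_mass_function:
  fixes q :: "'a::finite \<times> 'b::finite \<Rightarrow> real"
  assumes nonneg: "\<And>e. 0 \<le> q e"
    and rows: "\<And>x. (\<Sum>y\<in>UNIV. q (x, y)) = pmf \<mu> x"
    and cols: "\<And>y. (\<Sum>x\<in>UNIV. q (x, y)) = pmf \<nu> y"
  obtains \<pi> where "\<pi> \<in> couplings \<mu> \<nu>" and "pmf \<pi> = q"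
proof -
  have "(\<Sum>e\<in>UNIV. q e) = 1"
    by (simp add: sum_UNIV_prod rows sum_pmf_eq_1)
  then have "(\<integral>\<^sup>+ e. ennreal (q e) \<partial>count_space UNIV) = 1"
    using nonneg by (simp add: nn_integral_count_space_finite sum_ennreal)
  then have "pmf (embed_pmf q) = q"
    using nonneg by (intro ext pmf_embed_pmf) auto
  then show ?thesis
    using that[of "embed_pmf q"] rows cols by (simp add: couplings_iff_marginals)
qed

lemma transport_cost_infinite:
  assumes "\<And>e. c e \<noteq> -\<infinity>" and "e \<in> set_pmf \<pi>" and "c e = \<infinity>"
  shows "transport_cost c \<pi> = \<infinity>"
proof -
  have "0 < pmf \<pi> e"
    using assms(2) by (simp add: pmf_positive)
  with \<open>c e = \<infinity>\<close> have "c e * ereal (pmf \<pi> e) = \<infinity>"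
    by simp
  then show ?thesis
    by (auto simp: transport_cost_def case_prod_beta' sum_Pinfty
        intro!: exI[of _ "fst e"] exI[of _ "snd e"])
qed

lemma transport_cost_finite:
  assumes "\<And>e. e \<in> set_pmf \<pi> \<Longrightarrow> \<bar>c e\<bar> \<noteq> \<infinity>"
  shows "transport_cost c \<pi> = ereal (\<Sum>e\<in>UNIV. real_of_ereal (c e) * pmf \<pi> e)"
proof -
  have "c e * ereal (pmf \<pi> e) = ereal (real_of_ereal (c e) * pmf \<pi> e)" for e
    using assms[of e]
    by (cases "e \<in> set_pmf \<pi>")
      (auto simp: set_pmf_iff ereal_real' simp flip: times_ereal.simps(1) zero_ereal_def)
  then show ?thesis
    by (simp add: transport_cost_def case_prod_beta')
qed

section \<open>Global optimality\<close>

theorem corollary3p10: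
  fixes \<mu> :: "'a::finite pmf" and \<nu> :: "'b::finite pmf"
    and c :: "'a \<times> 'b \<Rightarrow> ereal"
    and N :: "('a \<times> 'b) set" and \<pi> :: "('a \<times> 'b) pmf"
  assumes "\<And>p. c p \<noteq> -\<infinity>"
    and "feasible c \<mu> \<nu> N"
    and "local_primal_optimizer c \<mu> \<nu> N \<pi>"
    and "shielding c \<pi> N"
  shows "globally_optimal c \<mu> \<nu> \<pi>"
proof -
  define k where "k e = real_of_ereal (c e)" for e
  define E where "E = {e \<in> N. c e \<noteq> \<infinity>}"
  have c_k: "c e = ereal (k e)" if "c e \<noteq> \<infinity>" for e
    using that assms(1)[of e] by (cases "c e") (auto simp: k_def)
  have pi_N: "\<pi> \<in> couplings \<mu> \<nu>" "set_pmf \<pi> \<subseteq> N"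
    using assms(3)
    by (auto simp: local_primal_optimizer_def is_arg_min_linorder restricted_couplings_def)
  have pi_opt: "transport_cost c \<pi> \<le> transport_cost c \<pi>'"
      if "\<pi>' \<in> couplings \<mu> \<nu>" "set_pmf \<pi>' \<subseteq> N" for \<pi>'
    using assms(3) that
    by (auto simp: local_primal_optimizer_def is_arg_min_linorder restricted_couplings_def)
  have cost: "transport_cost c \<pi>' = ereal (\<Sum>e\<in>UNIV. k e * pmf \<pi>' e)"
    if "\<And>e. e \<in> set_pmf \<pi>' \<Longrightarrow> c e \<noteq> \<infinity>" for \<pi>'
    unfolding k_def using that assms(1) by (intro transport_cost_finite) auto
  have "(INF \<pi>'\<in>restricted_couplings \<mu> \<nu> N. transport_cost c \<pi>') = transport_cost c \<pi>"
    using pi_N pi_opt by (intro antisym INF_lower INF_greatest) (auto simp: restricted_couplings_def)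
  then have "transport_cost c \<pi> \<noteq> \<infinity>"
    using assms(2) by (auto simp: feasible_def)
  then have pi_finite: "c e \<noteq> \<infinity>" if "e \<in> set_pmf \<pi>" for e
    using transport_cost_infinite[of c e \<pi>] assms(1) that by blast
  obtain \<alpha> \<beta> where feas_E: "\<And>x y. (x, y) \<in> E \<Longrightarrow> \<alpha> x + \<beta> y \<le> k (x, y)"
    and tight: "\<And>x y. 0 < pmf \<pi> (x, y) \<Longrightarrow> \<alpha> x + \<beta> y = k (x, y)"
  proof (rule optimal_plan_has_potentials[of "pmf \<pi>" E k])
    show "pmf \<pi> e = 0" if "e \<notin> E" for e
      using that pi_N(2) pi_finite[of e] by (auto simp: E_def set_pmf_iff)
  next
    fix q :: "'a \<times> 'b \<Rightarrow> real"
    assume q: "\<And>e. 0 \<le> q e" "\<And>e. e \<notin> E \<Longrightarrow> q e = 0"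
      "\<And>x. (\<Sum>y\<in>UNIV. q (x, y)) = (\<Sum>y\<in>UNIV. pmf \<pi> (x, y))"
      "\<And>y. (\<Sum>x\<in>UNIV. q (x, y)) = (\<Sum>x\<in>UNIV. pmf \<pi> (x, y))"
    have "\<And>x. (\<Sum>y\<in>UNIV. q (x, y)) = pmf \<mu> x" "\<And>y. (\<Sum>x\<in>UNIV. q (x, y)) = pmf \<nu> y"
      using q(3,4) pi_N(1) by (simp_all add: couplings_iff_marginals)
    with q(1) obtain \<pi>' where pi': "\<pi>' \<in> couplings \<mu> \<nu>" "pmf \<pi>' = q"
      by (rule coupling_of_mass_function)
    have "set_pmf \<pi>' \<subseteq> E"
      using q(2) unfolding pi'(2)[symmetric] set_pmf_iff subset_iff by blast
    then show "(\<Sum>e\<in>UNIV. k e * pmf \<pi> e) \<le> (\<Sum>e\<in>UNIV. k e * q e)"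
      using pi_opt[of \<pi>'] pi' cost[of \<pi>'] cost[of \<pi>] pi_finite by (auto simp: E_def subset_iff)
  qed auto
  have dual: "ereal (\<alpha> x + \<beta> y) \<le> c (x, y)" for x y
  proof (rule shielding_extends_dual_feasibility[OF assms(1) _ _ assms(4)])
    show "ereal (\<alpha> x + \<beta> y) \<le> c (x, y)" if "(x, y) \<in> N" for x y
      using feas_E[of x y] c_k[of "(x, y)"] that by (cases "c (x, y) = \<infinity>") (auto simp: E_def)
    show "c (x, y) = ereal (\<alpha> x + \<beta> y)" if "(x, y) \<in> set_pmf \<pi>" for x y
      using tight[of x y] c_k[of "(x, y)"] pi_finite that by (simp add: pmf_positive)
  qed
  have "transport_cost c \<pi> \<le> transport_cost c \<pi>'" if pi': "\<pi>' \<in> couplings \<mu> \<nu>" for \<pi>'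
  proof (cases "\<exists>e\<in>set_pmf \<pi>'. c e = \<infinity>")
    case True
    then show ?thesis
      using transport_cost_infinite[of c _ \<pi>'] assms(1) by auto
  next
    case False
    let ?D = "\<lambda>e. \<alpha> (fst e) + \<beta> (snd e)"
    have "(\<Sum>e\<in>UNIV. k e * pmf \<pi> e) = (\<Sum>e\<in>UNIV. ?D e * pmf \<pi> e)"
    proof (intro sum.cong refl)
      fix e show "k e * pmf \<pi> e = ?D e * pmf \<pi> e"
        using tight[of "fst e" "snd e"] pmf_nonneg[of \<pi> e] by (cases "pmf \<pi> e = 0") auto
    qed
    also have "\<dots> = (\<Sum>e\<in>UNIV. ?D e * pmf \<pi>' e)"
      using pi' pi_N(1) by (simp add: potential_cost_eq_marginals couplings_iff_marginals)
    also have "\<dots> \<le> (\<Sum>e\<in>UNIV. k e * pmf \<pi>' e)"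
    proof (intro sum_mono)
      fix e show "?D e * pmf \<pi>' e \<le> k e * pmf \<pi>' e"
        using dual[of "fst e" "snd e"] c_k[of e] False
        by (cases "e \<in> set_pmf \<pi>'") (auto simp: set_pmf_iff intro!: mult_right_mono)
    qed
    finally show ?thesis
      using False pi_finite cost[of \<pi>] cost[of \<pi>'] by auto
  qed
  then show ?thesis
    using pi_N(1) by (auto simp: globally_optimal_def is_arg_min_linorder)
qed

end
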